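(* Let $A$ be a finite-dimensional alternative algebra over a field of characteristic zero. Then $A$ is nilpotent if and only if $A$ admits an invertible Leibniz-derivation (of some order $n$).
   Context: An algebra is alternative if $(x,x,y)=(x,y,y)=0$ identically, where $(x,y,z)=(xy)z-x(yz)$. $A$ is nilpotent if there is $s$ such that every product of $s$ elements of $A$, in any arrangement of parentheses, is zero. A Leibniz-derivation (in the sense of Moens) of order $n$ of an algebra $A$ is a linear map $\phi:A\to A$ such that for all $x_1,\dots,x_n\in A$, $\phi((\cdots((x_1x_2)x_3)\cdots)x_n)=\sum_{i=1}^n(\cdots((x_1x_2)\cdots\phi(x_i))\cdots)x_n$, i.e. the sum of the left-normed products in which $x_i$ is replaced by $\phi(x_i)$. *)

theory Defs
  imports Main "HOL.Vector_Spaces"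
begin

text \<open>A (non-associative) algebra is modelled by a type 'v carrying an abelian group,
  a scalar multiplication scale by a field 'k making it a vector space, and a
  bilinear multiplication mult.\<close>

definition bilinear_mult :: "('k::field \<Rightarrow> 'v::ab_group_add \<Rightarrow> 'v) \<Rightarrow> ('v \<Rightarrow> 'v \<Rightarrow> 'v) \<Rightarrow> bool" where
  "bilinear_mult scale mult \<longleftrightarrow>
     (\<forall>x. Vector_Spaces.linear scale scale (mult x)) \<and>
     (\<forall>y. Vector_Spaces.linear scale scale (\<lambda>x. mult x y))"

definition assoc3 :: "('v::ab_group_add \<Rightarrow> 'v \<Rightarrow> 'v) \<Rightarrow> 'v \<Rightarrow> 'v \<Rightarrow> 'v \<Rightarrow> 'v" where
  "assoc3 mult x y z = mult (mult x y) z - mult x (mult y z)"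

definition alternative :: "('v::ab_group_add \<Rightarrow> 'v \<Rightarrow> 'v) \<Rightarrow> bool" where
  "alternative mult \<longleftrightarrow> (\<forall>x y. assoc3 mult x x y = 0 \<and> assoc3 mult x y y = 0)"

inductive is_product :: "('v \<Rightarrow> 'v \<Rightarrow> 'v) \<Rightarrow> nat \<Rightarrow> 'v \<Rightarrow> bool" for mult where
  single: "is_product mult 1 x"
| prod: "is_product mult i x \<Longrightarrow> is_product mult j y \<Longrightarrow> is_product mult (i + j) (mult x y)"

definition nilpotent_alg :: "('v::zero \<Rightarrow> 'v \<Rightarrow> 'v) \<Rightarrow> bool" where
  "nilpotent_alg mult \<longleftrightarrow> (\<exists>s\<ge>1. \<forall>z. is_product mult s z \<longrightarrow> z = 0)"

fun lnprod :: "('v \<Rightarrow> 'v \<Rightarrow> 'v) \<Rightarrow> 'v list \<Rightarrow> 'v" where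
  "lnprod mult [] = undefined"
| "lnprod mult (x # xs) = foldl mult x xs"

definition leibniz_derivation ::
  "('k::field \<Rightarrow> 'v::ab_group_add \<Rightarrow> 'v) \<Rightarrow> ('v \<Rightarrow> 'v \<Rightarrow> 'v) \<Rightarrow> nat \<Rightarrow> ('v \<Rightarrow> 'v) \<Rightarrow> bool" where
  "leibniz_derivation scale mult n \<phi> \<longleftrightarrow>
     Vector_Spaces.linear scale scale \<phi> \<and>
     (\<forall>xs. length xs = n \<longrightarrow>
        \<phi> (lnprod mult xs) = (\<Sum>i<n. lnprod mult (xs[i := \<phi> (xs ! i)])))"

end

theory Submission
  imports Defs
begin

text \<open>Write \<open>R x\<close> for right multiplication by \<open>x\<close> and \<open>t x\<close> for its trace. In an alternative algebra
  \<open>t (x y) = tr (R x R y)\<close> is an associative symmetric form; its radical is a nil ideal, and the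
  element representing the functional \<open>t\<close> is a unit \<open>e\<close> modulo the radical. A Leibniz-derivation
  \<open>\<phi>\<close> of order \<open>n\<close> satisfies \<open>[\<phi>, R x\<^sub>2 \<dots> R x\<^sub>n] = (\<Sum>i. R x\<^sub>2 \<dots> R (\<phi> x\<^sub>i) \<dots> R x\<^sub>n)\<close>, so the right-hand
  side has trace zero. Symmetrizing with \<open>e\<close> in most places turns this into invariance of the
  radical under \<open>\<phi>\<close>. Expanding \<open>\<phi> (e\<^sup>n)\<close> then gives \<open>\<phi> e = n \<phi> e\<close> modulo the radical, so \<open>\<phi> e\<close> and
  hence \<open>e\<close> lie in the radical, which is therefore the whole algebra. So the algebra is nil, and
  a nil finite-dimensional alternative algebra is nilpotent (Zorn). Conversely, the identity is a
  Leibniz-derivation of every order beyond the nilpotency index.\<close>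

subsection \<open>Traces of endomorphisms\<close>

context finite_dimensional_vector_space
begin

abbreviation endo :: "('b \<Rightarrow> 'b) \<Rightarrow> bool"
  where "endo \<equiv> Vector_Spaces.linear scale scale"

lemma endoI:
  assumes "\<And>x y. f (x + y) = f x + f y" "\<And>c x. f (scale c x) = scale c (f x)"
  shows "endo f"
  using assms vector_space_axioms by (simp add: linear_iff)

lemma endo_add: "endo f \<Longrightarrow> f (x + y) = f x + f y"
  by (simp add: linear_iff)

lemma endo_scale: "endo f \<Longrightarrow> f (scale c x) = scale c (f x)"
  by (simp add: linear_iff)

lemma endo_zero: "endo f \<Longrightarrow> f 0 = 0"
  using endo_add[of f 0 0] by simp

lemma endo_minus: "endo f \<Longrightarrow> f (- x) = - f x"
  using endo_add[of f x "- x"] by (simp add: endo_zero eq_neg_iff_add_eq_0 add.commute)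

lemma endo_diff: "endo f \<Longrightarrow> f (x - y) = f x - f y"
  using endo_add[of f x "- y"] by (simp add: endo_minus)

lemma endo_sum: "endo f \<Longrightarrow> f (sum g A) = (\<Sum>a\<in>A. f (g a))"
  by (induction A rule: infinite_finite_induct) (auto simp: endo_zero endo_add)

lemma endo_comp: "endo f \<Longrightarrow> endo g \<Longrightarrow> endo (\<lambda>x. f (g x))"
  by (rule endoI) (simp_all add: endo_add endo_scale)

lemma endo_plus: "endo f \<Longrightarrow> endo g \<Longrightarrow> endo (\<lambda>x. f x + g x)"
  by (rule endoI) (simp_all add: endo_add endo_scale algebra_simps)

lemma endo_const_zero: "endo (\<lambda>x. 0)"
  by (rule endoI) simp_all

lemma endo_scaled: "endo f \<Longrightarrow> endo (\<lambda>x. scale c (f x))"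
  by (rule endoI) (simp_all add: endo_add endo_scale algebra_simps)

lemma endo_funpow: "endo f \<Longrightarrow> endo (f ^^ n)"
  by (induction n) (auto intro: endoI simp: endo_add endo_scale)

lemma subspace_endo_vimage: "endo f \<Longrightarrow> subspace S \<Longrightarrow> subspace {x. f x \<in> S}"
  by (simp add: subspace_def endo_zero endo_add endo_scale)

lemma subspace_endo_image: "endo f \<Longrightarrow> subspace S \<Longrightarrow> subspace (f ` S)"
  by (auto simp: subspace_def endo_add[symmetric] endo_scale[symmetric]
      intro!: image_eqI[where f = f] endo_zero[symmetric])

text \<open>For independent \<open>C\<close> with \<open>span C\<close> invariant under
  \<open>f\<close>, this is the trace of the restriction of \<open>f\<close> to
  \<open>span C\<close>. The parameter \<open>C\<close> allows bases adapted to an image.\<close>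

definition trace_on :: "'b set \<Rightarrow> ('b \<Rightarrow> 'b) \<Rightarrow> 'a"
  where "trace_on C f = (\<Sum>c\<in>C. representation C (f c) c)"

abbreviation tr :: "('b \<Rightarrow> 'b) \<Rightarrow> 'a"
  where "tr \<equiv> trace_on Basis"

lemma sum_representation:
  assumes "independent C" "v \<in> span C"
  shows "(\<Sum>c\<in>C. scale (representation C v c) c) = v"
  by (rule sum_representation_eq) (use assms finiteI_independent in auto)

text \<open>Expanding each \<open>d\<close> of \<open>D\<close> in \<open>C\<close> and each
  \<open>f c\<close> in \<open>D\<close> turns both traces into the same double sum.\<close>

lemma trace_on_cong_span:
  assumes "endo f" "independent C" "independent D" "span C = span D" "f ` span C \<subseteq> span C"
  shows "trace_on C f = trace_on D f"
proof -
  have in_span: "f c \<in> span D" if "c \<in> C" for c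
    using assms that span_base by blast
  have "trace_on D f = (\<Sum>d\<in>D. representation D (f d) d)"
    by (simp add: trace_on_def)
  also have "\<dots> = (\<Sum>d\<in>D. \<Sum>c\<in>C. representation C d c * representation D (f c) d)"
  proof (rule sum.cong)
    fix d assume d: "d \<in> D"
    then have "d \<in> span C" using assms span_base by blast
    then have "f d = f (\<Sum>c\<in>C. scale (representation C d c) c)"
      using sum_representation[OF assms(2)] by simp
    also have "\<dots> = (\<Sum>c\<in>C. scale (representation C d c) (f c))"
      using assms(1) by (simp add: endo_sum endo_scale)
    finally show "representation D (f d) d = (\<Sum>c\<in>C. representation C d c * representation D (f c) d)"
      using assms(3) in_span by (simp add: representation_sum representation_scale span_scale)
  qed simp
  also have "\<dots> = (\<Sum>c\<in>C. \<Sum>d\<in>D. representation D (f c) d * representation C d c)"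
    by (subst sum.swap) (simp add: mult.commute)
  also have "\<dots> = (\<Sum>c\<in>C. representation C (\<Sum>d\<in>D. scale (representation D (f c) d) d) c)"
  proof (rule sum.cong)
    fix c
    have D: "D \<subseteq> span C" using assms(4) span_superset by blast
    show "(\<Sum>d\<in>D. representation D (f c) d * representation C d c) =
      representation C (\<Sum>d\<in>D. scale (representation D (f c) d) d) c"
      using assms(2) D by (subst representation_sum) (auto intro!: span_scale sum.cong simp: representation_scale subset_iff)
  qed simp
  also have "\<dots> = trace_on C f"
    unfolding trace_on_def using in_span sum_representation[OF assms(3)] by (intro sum.cong) auto
  finally show ?thesis by simp
qed

text \<open>All coordinates of \<open>f d\<close> belong to vectors of \<open>C\<close>, so the
  diagonal entries outside \<open>C\<close> are zero.\<close>

lemma trace_on_restrict: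
  assumes "independent D" "C \<subseteq> D" "f ` span D \<subseteq> span C"
  shows "trace_on D f = trace_on C f"
proof -
  have fin: "finite D" using assms finiteI_independent by auto
  have rep: "representation D (f d) = representation C (f d)" if "d \<in> D" for d
    using assms that span_base by (intro representation_extend) auto
  have "trace_on D f = (\<Sum>d\<in>D. representation C (f d) d)"
    unfolding trace_on_def by (simp add: rep)
  also have "\<dots> = (\<Sum>d\<in>C. representation C (f d) d)"
    using assms fin by (intro sum.mono_neutral_right) (auto dest: representation_ne_zero)
  finally show ?thesis by (simp add: trace_on_def)
qed

lemma tr_add: "tr (\<lambda>x. f x + g x) = tr f + tr g"
  unfolding trace_on_def
  by (simp add: representation_add independent_Basis span_Basis sum.distrib)

lemma tr_scale: "tr (\<lambda>x. scale c (f x)) = c * tr f"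
  unfolding trace_on_def
  by (simp add: representation_scale independent_Basis span_Basis sum_distrib_left)

lemma tr_diff: "tr (\<lambda>x. f x - g x) = tr f - tr g"
  unfolding trace_on_def
  by (simp add: representation_diff independent_Basis span_Basis sum_subtractf)

lemma tr_comp_representation:
  assumes "endo f"
  shows "tr (\<lambda>x. f (g x)) =
    (\<Sum>b\<in>Basis. \<Sum>c\<in>Basis. representation Basis (g b) c * representation Basis (f c) b)"
  unfolding trace_on_def
proof (rule sum.cong)
  fix b
  have "f (g b) = f (\<Sum>c\<in>Basis. scale (representation Basis (g b) c) c)"
    using sum_representation[OF independent_Basis] span_Basis by simp
  also have "\<dots> = (\<Sum>c\<in>Basis. scale (representation Basis (g b) c) (f c))"
    using assms by (simp add: endo_sum endo_scale)
  finally show "representation Basis (f (g b)) b =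
      (\<Sum>c\<in>Basis. representation Basis (g b) c * representation Basis (f c) b)"
    using independent_Basis span_Basis by (simp add: representation_sum representation_scale)
qed simp

lemma tr_comm:
  assumes "endo f" "endo g"
  shows "tr (\<lambda>x. f (g x)) = tr (\<lambda>x. g (f x))"
  unfolding tr_comp_representation[OF assms(1)] tr_comp_representation[OF assms(2)]
  by (subst sum.swap) (simp add: mult.commute)

text \<open>On the image of \<open>span C\<close> the exponent \<open>m\<close> suffices, and in a
  basis of \<open>span C\<close> extending a basis of the image only the latter contributes to the
  trace. \<open>C\<close> stays arbitrary because the induction passes to the image.\<close>

lemma trace_on_nilpotent:
  assumes f: "endo f"
  shows "independent C \<Longrightarrow> f ` span C \<subseteq> span C \<Longrightarrow> (\<forall>x\<in>span C. (f ^^ m) x = 0) \<Longrightarrow> trace_on C f = 0"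
proof (induction m arbitrary: C)
  case 0
  have "C = {}"
  proof (rule ccontr)
    assume "C \<noteq> {}"
    then obtain c where c: "c \<in> C" by blast
    then have "c = 0" using 0 span_base by auto
    then show False using c 0 dependent_zero by blast
  qed
  then show ?case by (simp add: trace_on_def)
next
  case (Suc m)
  have sub: "subspace (f ` span C)" using f subspace_endo_image by blast
  obtain D where D: "D \<subseteq> f ` span C" "independent D" "f ` span C \<subseteq> span D"
    using basis_exists by metis
  then have spD: "span D = f ` span C"
    using sub span_minimal by blast
  obtain E where E: "D \<subseteq> E" "E \<subseteq> span C" "independent E" "span C \<subseteq> span E"
    by (rule maximal_independent_subset_extend[OF subset_trans[OF D(1) Suc.prems(2)] D(2)])
  then have spE: "span E = span C" using span_minimal[OF E(2)] by auto
  have "trace_on C f = trace_on E f"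
    using trace_on_cong_span[OF f Suc.prems(1) E(3)] spE Suc.prems by simp
  also have "\<dots> = trace_on D f"
    using trace_on_restrict[OF E(3,1)] spE spD by simp
  also have "\<dots> = 0"
  proof (rule Suc.IH[OF D(2)])
    show "f ` span D \<subseteq> span D" using spD Suc.prems by auto
    show "\<forall>x\<in>span D. (f ^^ m) x = 0"
    proof
      fix x assume "x \<in> span D"
      then obtain y where "y \<in> span C" "x = f y" using spD by auto
      then show "(f ^^ m) x = 0" using Suc.prems(3) by (simp add: funpow_swap1)
    qed
  qed
  finally show ?case .
qed

lemma tr_nilpotent:
  assumes "endo f" "\<And>x. (f ^^ m) x = 0"
  shows "tr f = 0"
  using trace_on_nilpotent[OF assms(1) independent_Basis] assms(2) span_Basis by auto

text \<open>In a basis extending one of the range, \<open>f\<close> fixes the vectors of the range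
  basis, and the others contribute nothing.\<close>

lemma tr_idempotent:
  assumes f: "endo f" and idem: "\<And>x. f (f x) = f x"
  shows "tr f = of_nat (dim (range f))"
proof -
  have sub: "subspace (range f)" using f subspace_endo_image by simp
  obtain D where D: "D \<subseteq> range f" "independent D" "range f \<subseteq> span D" "card D = dim (range f)"
    using basis_exists by metis
  then have spD: "span D = range f"
    using sub span_minimal by blast
  obtain E where E: "D \<subseteq> E" "independent E" "UNIV \<subseteq> span E"
    by (rule maximal_independent_subset_extend[OF subset_UNIV D(2)])
  have "tr f = trace_on E f"
    using E span_Basis by (intro trace_on_cong_span[OF f independent_Basis E(2)]) auto
  also have "\<dots> = trace_on D f"
    using E spD by (intro trace_on_restrict) auto
  also have "\<dots> = (\<Sum>d\<in>D. 1)"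
    unfolding trace_on_def using D idem
    by (intro sum.cong) (auto simp: representation_basis image_iff subset_iff)
  finally show ?thesis using D by simp
qed

text \<open>Serves to represent the functional \<open>t\<close> by an element. If \<open>F j\<close>
  vanishes on the common kernel of the other functionals, its coefficient is 0; otherwise a multiple
  of \<open>F j\<close> is subtracted so that \<open>g\<close> vanishes at a vector \<open>y\<close>
  of that kernel with \<open>F j y \<noteq> 0\<close>.\<close>

lemma functional_in_span:
  fixes g :: "'b \<Rightarrow> 'a" and F :: "'i \<Rightarrow> 'b \<Rightarrow> 'a"
  assumes "finite I"
    and F: "\<And>i x y. i \<in> I \<Longrightarrow> F i (x + y) = F i x + F i y"
           "\<And>i c x. i \<in> I \<Longrightarrow> F i (scale c x) = c * F i x"
    and "\<And>x y. g (x + y) = g x + g y" "\<And>c x. g (scale c x) = c * g x"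
    and "\<And>x. (\<And>i. i \<in> I \<Longrightarrow> F i x = 0) \<Longrightarrow> g x = 0"
  shows "\<exists>a. \<forall>x. g x = (\<Sum>i\<in>I. a i * F i x)"
  using assms
proof (induction I arbitrary: g rule: finite_induct)
  case empty
  then show ?case by simp
next
  case (insert j I)
  show ?case
  proof (cases "\<forall>x. (\<forall>i\<in>I. F i x = 0) \<longrightarrow> F j x = 0")
    case True
    have "\<exists>a. \<forall>x. g x = (\<Sum>i\<in>I. a i * F i x)"
    proof (rule insert.IH)
      fix x assume "\<And>i. i \<in> I \<Longrightarrow> F i x = 0"
      then show "g x = 0" using insert.prems(5)[of x] True by blast
    qed (use insert.prems(1-4) in auto)
    then obtain a where "\<forall>x. g x = (\<Sum>i\<in>I. a i * F i x)" by blast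
    then have "\<forall>x. g x = (\<Sum>i\<in>insert j I. (a(j := 0)) i * F i x)"
      using insert.hyps by (auto intro!: sum.cong)
    then show ?thesis by blast
  next
    case False
    then obtain y where y: "\<And>i. i \<in> I \<Longrightarrow> F i y = 0" "F j y \<noteq> 0" by blast
    define b where "b = g y / F j y"
    have "\<exists>a. \<forall>x. g x - b * F j x = (\<Sum>i\<in>I. a i * F i x)"
    proof (rule insert.IH)
      fix x assume x: "\<And>i. i \<in> I \<Longrightarrow> F i x = 0"
      \<comment> \<open>The projection of \<open>x\<close> along \<open>y\<close> to the kernel of
        \<open>F j\<close>; the functionals indexed by \<open>I\<close> do not see the
        change.\<close>
      define z where "z = x + scale (- (F j x / F j y)) y"
      have "F i z = 0" if "i \<in> insert j I" for i
        using that x y by (auto simp add: insert.prems(1,2) z_def simp del: scale_minus_left)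
      then have "g z = 0" using insert.prems(5) by blast
      then show "g x - b * F j x = 0"
        by (simp add: insert.prems(3,4) z_def b_def del: scale_minus_left)
    qed (use insert.prems(1-4) in \<open>simp_all add: algebra_simps\<close>)
    then obtain a where a: "\<And>x. g x - b * F j x = (\<Sum>i\<in>I. a i * F i x)" by blast
    have "(\<Sum>i\<in>I. (a(j := b)) i * F i x) = (\<Sum>i\<in>I. a i * F i x)" for x
      using insert.hyps by (intro sum.cong) auto
    then have "\<forall>x. g x = (\<Sum>i\<in>insert j I. (a(j := b)) i * F i x)"
      using insert.hyps a[symmetric] by simp
    then show ?thesis by blast
  qed
qed

end

subsection \<open>The trace form of an alternative algebra\<close>

locale alternative_algebra = finite_dimensional_vector_space scale Basis
  for scale :: "'k::field_char_0 \<Rightarrow> 'v::ab_group_add \<Rightarrow> 'v" (infixr "*s" 75)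
    and Basis :: "'v set" +
  fixes mult :: "'v \<Rightarrow> 'v \<Rightarrow> 'v" (infixl "\<odot>" 70)
  assumes bilinear: "bilinear_mult scale mult"
    and alt: "alternative mult"
begin

abbreviation (input) R :: "'v \<Rightarrow> 'v \<Rightarrow> 'v"
  where "R x \<equiv> (\<lambda>z. z \<odot> x)"

lemma endo_R: "endo (R x)" and endo_L: "endo (mult x)"
  using bilinear by (auto simp: bilinear_mult_def)

lemma mult_add: "x \<odot> (y + z) = x \<odot> y + x \<odot> z" "(x + y) \<odot> z = x \<odot> z + y \<odot> z"
  and mult_diff: "x \<odot> (y - z) = x \<odot> y - x \<odot> z" "(x - y) \<odot> z = x \<odot> z - y \<odot> z"
  and mult_scale: "x \<odot> (a *s y) = a *s (x \<odot> y)" "(a *s x) \<odot> y = a *s (x \<odot> y)"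
  and mult_zero: "x \<odot> 0 = 0" "0 \<odot> x = 0"
  using endo_add[OF endo_R] endo_add[OF endo_L] endo_diff[OF endo_R] endo_diff[OF endo_L]
    endo_scale[OF endo_R] endo_scale[OF endo_L] endo_zero[OF endo_R] endo_zero[OF endo_L]
  by auto

section \<open>Associators and linearized alternative laws\<close>

abbreviation assoc :: "'v \<Rightarrow> 'v \<Rightarrow> 'v \<Rightarrow> 'v"
  where "assoc \<equiv> assoc3 mult"

text \<open>Linearization: in the expansion of \<open>assoc (x + y) (x + y) z = 0\<close> only the
  mixed terms survive. With \<open>assoc_swap23\<close> this makes the associator
  alternating.\<close>

lemma assoc_swap12: "assoc y x z = - assoc x y z"
proof -
  have "assoc (x + y) (x + y) z = 0" "assoc x x z = 0" "assoc y y z = 0"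
    using alt by (simp_all add: alternative_def)
  then show ?thesis
    by (simp add: assoc3_def mult_add algebra_simps)
qed

lemma assoc_swap23: "assoc x z y = - assoc x y z"
proof -
  have "assoc x (y + z) (y + z) = 0" "assoc x y y = 0" "assoc x z z = 0"
    using alt by (simp_all add: alternative_def)
  then show ?thesis
    by (simp add: assoc3_def mult_add algebra_simps)
qed

lemma assoc_rotate: "assoc y z x = assoc x y z"
  using assoc_swap12[of y x z] assoc_swap23[of y x z] by simp

text \<open>In operator form: \<open>R\<close> turns the symmetrized product into the symmetrized
  composition. The formulas for powers and the symmetrization with \<open>e\<close> rest on
  this.\<close>

lemma R_jordan: "z \<odot> (x \<odot> y + y \<odot> x) = (z \<odot> y) \<odot> x + (z \<odot> x) \<odot> y"
  using assoc_swap23[of z x y] by (simp add: assoc3_def mult_add algebra_simps)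

lemma L_jordan: "(x \<odot> y + y \<odot> x) \<odot> z = x \<odot> (y \<odot> z) + y \<odot> (x \<odot> z)"
  using assoc_swap12[of x y z] by (simp add: assoc3_def mult_add algebra_simps)

lemma scale_2: "x + x = 2 *s x"
  using scale_left_distrib[of 1 1 x] by simp

lemma double_cancel: "x + x = y + y \<Longrightarrow> x = (y :: 'v)"
  by (simp add: scale_2)

lemma funpow_commute: "(\<And>z. f (g z) = g (f z)) \<Longrightarrow> (f ^^ n) (g z) = g ((f ^^ n) z)"
  by (induction n) simp_all

text \<open>In characteristic zero the rank of \<open>f\<close>, read in the field, vanishes only if
  the rank is 0.\<close>

lemma tr_idempotent_eq_0:
  assumes "endo f" "\<And>x. f (f x) = f x" "tr f = 0"
  shows "f x = 0"
proof -
  have "dim (range f) = 0" using tr_idempotent[of f] assms by simp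
  then show ?thesis by auto
qed

text \<open>\<open>pow x n\<close> is the power of exponent \<open>n + 1\<close>, as there is no unit.\<close>

definition pow :: "'v \<Rightarrow> nat \<Rightarrow> 'v"
  where "pow x n = (R x ^^ n) x"

lemma pow_0 [simp]: "pow x 0 = x"
  by (simp add: pow_def)

lemma pow_Suc: "pow x (Suc n) = pow x n \<odot> x"
  by (simp add: pow_def)

text \<open>The elements \<open>x\<close> and \<open>pow x n\<close> commute by the induction
  hypothesis, so twice \<open>pow x (Suc n)\<close> is their symmetrized product. The Jordan
  identities give its multiplications, and the factor 2 is cancelled.\<close>

lemma mult_pow: "z \<odot> pow x n = (R x ^^ Suc n) z" "pow x n \<odot> z = (mult x ^^ Suc n) z"
proof (induction n arbitrary: z)
  case (Suc n)
  have comm: "x \<odot> pow x n = pow x n \<odot> x"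
    unfolding Suc(1) by (simp add: pow_def)
  {
    case 1
    have "z \<odot> pow x (Suc n) + z \<odot> pow x (Suc n) = R (x \<odot> pow x n + pow x n \<odot> x) z"
      by (simp add: pow_Suc comm mult_add)
    also have "\<dots> = (R x ^^ Suc (Suc n)) z + (R x ^^ Suc (Suc n)) z"
      using R_jordan[of z x "pow x n"] funpow_commute[of "R x" "R x" n z] by (simp add: Suc(1))
    finally show ?case by (rule double_cancel)
  next
    case 2
    have "pow x (Suc n) \<odot> z + pow x (Suc n) \<odot> z = (x \<odot> pow x n + pow x n \<odot> x) \<odot> z"
      by (simp add: pow_Suc comm mult_add)
    also have "\<dots> = (mult x ^^ Suc (Suc n)) z + (mult x ^^ Suc (Suc n)) z"
      using L_jordan[of x "pow x n" z] by (simp add: Suc(2) funpow_swap1)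
    finally show ?case by (rule double_cancel)
  }
qed simp_all

lemma pow_mult_pow: "pow x i \<odot> pow x j = pow x (Suc (i + j))"
  unfolding mult_pow(1) by (simp add: pow_def funpow_add[symmetric, THEN fun_cong, simplified] add.commute)

section \<open>The trace form and its radical\<close>

definition t :: "'v \<Rightarrow> 'k"
  where "t x = tr (R x)"

lemma t_add: "t (x + y) = t x + t y"
  unfolding t_def using tr_add[of "R x" "R y"] by (simp add: mult_add)

lemma t_scale: "t (a *s x) = a * t x"
  unfolding t_def by (simp add: mult_scale tr_scale)

lemma t_diff: "t (x - y) = t x - t y"
  unfolding t_def by (simp add: mult_diff tr_diff)

lemma t_zero: "t 0 = 0"
  using t_add[of 0 0] by simp

text \<open>As an operator in \<open>z\<close>, \<open>assoc z y x\<close> is the commutator of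
  \<open>R y\<close> with left multiplication by \<open>x\<close>, so its trace is zero.\<close>

lemma t_mult: "t (y \<odot> x) = tr (\<lambda>z. (z \<odot> y) \<odot> x)"
proof -
  have "tr (\<lambda>z. assoc z y x) = tr (\<lambda>z. R y (x \<odot> z) - x \<odot> R y z)"
    by (rule arg_cong[where f = tr]) (use assoc_rotate in \<open>auto simp: assoc3_def\<close>)
  also have "\<dots> = 0"
    using tr_comm[OF endo_R[of y] endo_L[of x]] by (subst tr_diff) simp
  finally show ?thesis
    by (simp add: assoc3_def t_def tr_diff)
qed

lemma t_comm: "t (x \<odot> y) = t (y \<odot> x)"
  unfolding t_mult using tr_comm[OF endo_R endo_R] by simp

text \<open>All three cyclic rotations of an associator agree, and by commutativity of \<open>t\<close> their traces
  sum to a telescoping sum; hence three times the trace vanishes.\<close>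

lemma t_assoc: "t ((x \<odot> y) \<odot> z) = t (x \<odot> (y \<odot> z))"
proof -
  have t3: "t (assoc a b c) = t ((a \<odot> b) \<odot> c) - t ((b \<odot> c) \<odot> a)" for a b c
    by (simp add: assoc3_def t_diff t_comm[of a])
  have "assoc y z x = assoc x y z" "assoc z x y = assoc x y z"
    using assoc_rotate by metis+
  then have "3 * t (assoc x y z) = t (assoc x y z) + t (assoc y z x) + t (assoc z x y)"
    by simp
  also have "\<dots> = 0"
    unfolding t3 by simp
  finally show ?thesis
    by (simp add: assoc3_def t_diff)
qed

definition rad :: "'v set"
  where "rad = {x. \<forall>y. t (x \<odot> y) = 0}"

lemma radD: "x \<in> rad \<Longrightarrow> t (x \<odot> y) = 0" "x \<in> rad \<Longrightarrow> t (y \<odot> x) = 0"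
  using t_comm by (auto simp: rad_def)

lemma radI: "(\<And>y. t (x \<odot> y) = 0) \<Longrightarrow> x \<in> rad"
  by (auto simp: rad_def)

lemma subspace_rad: "subspace rad"
  by (auto simp: subspace_def rad_def mult_add mult_scale mult_zero t_add t_scale t_zero)

lemma rad_mult: "x \<in> rad \<Longrightarrow> x \<odot> y \<in> rad" "x \<in> rad \<Longrightarrow> y \<odot> x \<in> rad"
proof -
  assume x: "x \<in> rad"
  show "x \<odot> y \<in> rad" using x by (intro radI) (simp add: t_assoc radD)
  show "y \<odot> x \<in> rad"
  proof (rule radI)
    fix z
    have "t ((y \<odot> x) \<odot> z) = t (x \<odot> (z \<odot> y))"
      using t_assoc[of y x z] t_comm[of y] t_assoc[of x z y] by simp
    then show "t ((y \<odot> x) \<odot> z) = 0" using x by (simp add: radD)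
  qed
qed

section \<open>Nilpotency of the elements of the radical\<close>

lemma pow_rad: "x \<in> rad \<Longrightarrow> pow x n \<in> rad"
  by (induction n) (auto simp: pow_Suc rad_mult)

text \<open>The spans of the powers of index at least \<open>m\<close> decrease as \<open>m\<close>
  grows; one of minimal dimension equals its successor.\<close>

lemma pow_relation: "\<exists>m. pow x m \<in> span {pow x i | i. i > m}"
proof -
  define S where "S m = span {pow x i | i. i \<ge> m}" for m
  obtain m where m: "\<And>j. dim (S m) \<le> dim (S j)"
    using ex_has_least_nat[of "\<lambda>_. True" 0 "\<lambda>m. dim (S m)"] by auto
  have "S (Suc m) \<subseteq> S m"
    unfolding S_def by (rule span_mono) auto
  then have "S (Suc m) = S m"
    using m by (intro subspace_dim_equal) (auto simp: S_def)
  moreover have "pow x m \<in> S m"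
    unfolding S_def by (rule span_base) auto
  ultimately show ?thesis
    by (auto simp: S_def Suc_le_eq)
qed

text \<open>Formally \<open>y\<close> is \<open>pow x m\<close> times \<open>u\<close>, where
  \<open>u\<close> is a combination of powers of \<open>x\<close> without constant term. Hence
  \<open>u\<close> lies in the radical and \<open>R u\<close> has a factor \<open>R x\<close>; the
  cofactor \<open>Q\<close> is a polynomial in \<open>R x\<close>.\<close>

lemma span_high_powers:
  assumes "x \<in> rad" "y \<in> span {pow x i | i. i > m}"
  shows "\<exists>Q u. endo Q \<and> u \<in> rad \<and> (\<forall>z. Q (R x z) = R x (Q z)) \<and> (\<forall>z. R u z = R x (Q z)) \<and>
    (\<forall>z. R y z = (R x ^^ Suc m) (R u z))"
  using assms(2)
proof (induction rule: span_induct_alt)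
  case base
  have "(R x ^^ k) 0 = 0" for k by (rule endo_zero[OF endo_funpow[OF endo_R]])
  then show ?case
    using subspace_0[OF subspace_rad]
    by (intro exI[of _ "\<lambda>_. 0"] exI[of _ 0]) (simp add: endo_const_zero mult_zero del: funpow.simps)
next
  case (step c p y)
  from step(1) obtain i where i: "i > m" "p = pow x i" by auto
  \<comment> \<open>Index \<open>i\<close> stands for exponent \<open>i + 1\<close>, which splits as
    \<open>(m + 1) + (j + 1)\<close>.\<close>
  define j where "j = i - Suc m"
  have ij: "Suc i = Suc m + Suc j" using i by (simp add: j_def)
  from step(2) obtain Q u where Q: "endo Q" "u \<in> rad" "\<And>z. Q (R x z) = R x (Q z)"
    "\<And>z. R u z = R x (Q z)" "\<And>z. R y z = (R x ^^ Suc m) (R u z)" by blast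
  let ?Q = "\<lambda>z. c *s (R x ^^ j) z + Q z"
  let ?u = "c *s pow x j + u"
  have E: "endo (R x ^^ k)" for k by (rule endo_funpow[OF endo_R])
  show ?case
  proof (intro exI[of _ ?Q] exI[of _ ?u] conjI allI)
    show "endo ?Q" by (intro endo_plus endo_scaled E Q)
    show "?u \<in> rad"
      using assms(1) Q(2) by (intro subspace_add subspace_scale subspace_rad pow_rad)
    fix z
    have "(R x ^^ j) (R x z) = R x ((R x ^^ j) z)"
      by (rule funpow_commute) (rule refl)
    then show "?Q (R x z) = R x (?Q z)"
      by (simp add: mult_add mult_scale Q(3))
    show u: "R ?u z = R x (?Q z)"
      using Q(4)[of z] by (simp add: mult_add mult_scale mult_pow)
    have "R (c *s p + y) z = c *s (R x ^^ Suc m) ((R x ^^ Suc j) z) + (R x ^^ Suc m) (R u z)"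
      by (simp only: mult_add mult_scale i(2) mult_pow ij funpow_add o_apply Q(5))
    also have "\<dots> = (R x ^^ Suc m) (R ?u z)"
      by (simp only: endo_add[OF E] endo_scale[OF E] mult_add mult_scale mult_pow)
    finally show "R (c *s p + y) z = (R x ^^ Suc m) (R ?u z)" .
  qed
qed

lemma funpow_comp_commute:
  assumes "\<And>z. f (g z) = g (f z)"
  shows "((\<lambda>z. f (g z)) ^^ n) z = (f ^^ n) ((g ^^ n) z)"
proof (induction n)
  case (Suc n)
  have "f (g ((f ^^ n) ((g ^^ n) z))) = f ((f ^^ n) (g ((g ^^ n) z)))"
    using funpow_commute[of f g n, OF assms] by simp
  then show ?case using Suc by (simp add: funpow_swap1)
qed simp

text \<open>A relation \<open>T\<^sup>m = T\<^sup>m E\<close> with \<open>E = R u\<close> and \<open>u\<close> a combination of powers of \<open>x\<close> makes a power of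
  \<open>E\<close> idempotent; its trace vanishes because \<open>u\<close> lies in the radical of the trace form.\<close>

lemma rad_nil:
  assumes x: "x \<in> rad"
  shows "\<exists>m. \<forall>z. (R x ^^ m) z = 0"
proof -
  obtain m where "pow x m \<in> span {pow x i | i. i > m}" using pow_relation by blast
  from span_high_powers[OF x this] obtain Q u where Q: "endo Q" "u \<in> rad"
    "\<And>z. Q (R x z) = R x (Q z)" "\<And>z. R u z = R x (Q z)"
    "\<And>z. R (pow x m) z = (R x ^^ Suc m) (R u z)" by blast
  define T where "T = R x ^^ Suc m"
  define F where "F = R u ^^ Suc m"
  have TE: "T (R u z) = T z" for z
    using Q(5)[of z] by (simp only: T_def mult_pow)
  have comm: "R x (R u z) = R u (R x z)" for z
    using Q(3)[of z] by (simp add: Q(4))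
  have Tcomm: "T (R u z) = R u (T z)" for z
    unfolding T_def using funpow_commute[of "R x" "R u"] comm by blast
  have R_u: "R u = (\<lambda>z. R x (Q z))" using Q(4) by (rule ext)
  \<comment> \<open>\<open>R u\<close> is the product of the commuting operators \<open>R x\<close>
    and \<open>Q\<close>, so \<open>F\<close> factors through \<open>T\<close>. Thus
    \<open>R u\<close> acts as the identity on the range of \<open>F\<close>, which makes
    \<open>F\<close> idempotent.\<close>
  have F: "F z = T ((Q ^^ Suc m) z)" for z
    unfolding F_def T_def R_u using funpow_comp_commute[of "R x" Q "Suc m" z] Q(3) by metis
  have EF: "R u (F z) = F z" for z
    unfolding F Tcomm[symmetric] TE ..
  have EnF: "(R u ^^ n) (F z) = F z" for n z
    by (induction n) (simp_all add: EF)
  \<comment> \<open>One more factor \<open>R u\<close> changes nothing by \<open>EF\<close>, but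
    makes \<open>F\<close> the right multiplication by a genuine product with last factor
    \<open>u\<close>, also when \<open>m = 0\<close>. The trace of such a product is covered by the
    definition of \<open>rad\<close>.\<close>
  have "F = R u ^^ Suc (Suc m)"
    using EF by (auto simp: F_def)
  then have "F = R (pow u (Suc m))"
    using mult_pow(1)[of _ u "Suc m"] by auto
  then have "tr F = t (pow u m \<odot> u)"
    by (simp add: t_def pow_Suc)
  then have "tr F = 0"
    using Q(2) by (simp add: radD)
  moreover have "endo F" unfolding F_def by (intro endo_funpow endo_R)
  moreover have "F (F z) = F z" for z
    using EnF[of "Suc m" z] by (simp only: F_def)
  ultimately have F0: "F z = 0" for z
    by (intro tr_idempotent_eq_0)
  have "T ((R u ^^ n) z) = T z" for n z
    by (induction n) (simp_all add: TE)
  from this[of "Suc m"] have "T z = T (F z)" for z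
    by (simp only: F_def)
  then have "T z = 0" for z
    using F0 endo_zero[OF endo_funpow[OF endo_R]] by (metis T_def)
  then show ?thesis unfolding T_def by blast
qed

text \<open>The definition of \<open>rad\<close> only concerns \<open>t\<close> of products, and
  there is no unit to specialize to; nilpotency of \<open>R x\<close> gives the claim.\<close>

lemma t_rad: "x \<in> rad \<Longrightarrow> t x = 0"
  unfolding t_def using rad_nil tr_nilpotent[OF endo_R] by blast

text \<open>The common kernel of the functionals \<open>t (b \<odot> x)\<close> is
  \<open>rad\<close>, where \<open>t\<close> vanishes. So \<open>t\<close> is a combination of them,
  and its coefficients define \<open>e\<close>. Associativity of the form makes \<open>e\<close> a
  two-sided unit modulo \<open>rad\<close>.\<close>

lemma unit_mod_rad: "\<exists>e. \<forall>x. t x = t (e \<odot> x) \<and> e \<odot> x - x \<in> rad \<and> x \<odot> e - x \<in> rad"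
proof -
  have "\<exists>a. \<forall>x. t x = (\<Sum>b\<in>Basis. a b * t (b \<odot> x))"
  proof (rule functional_in_span)
    fix x assume *: "\<And>b. b \<in> Basis \<Longrightarrow> t (b \<odot> x) = 0"
    have "subspace {y. t (y \<odot> x) = 0}"
      by (auto simp: subspace_def mult_add mult_scale mult_zero t_add t_scale t_zero)
    then have "span Basis \<subseteq> {y. t (y \<odot> x) = 0}"
      using * by (intro span_minimal) auto
    then have "x \<in> rad"
      using span_Basis t_comm by (intro radI) auto
    then show "t x = 0" by (rule t_rad)
  qed (simp_all add: finite_Basis mult_add mult_scale t_add t_scale)
  then obtain a where a: "\<And>x. t x = (\<Sum>b\<in>Basis. a b * t (b \<odot> x))" by blast
  have t_sum: "t (sum f A) = (\<Sum>i\<in>A. t (f i))" for f and A :: "'v set"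
    by (induction A rule: infinite_finite_induct) (simp_all add: t_add t_zero)
  define e where "e = (\<Sum>b\<in>Basis. a b *s b)"
  have e: "t (e \<odot> x) = t x" for x
    unfolding e_def endo_sum[OF endo_R] by (simp add: t_sum mult_scale t_scale a[of x])
  have "e \<odot> x - x \<in> rad" for x
    by (rule radI) (simp add: mult_diff t_diff t_assoc e)
  moreover have "x \<odot> e - x \<in> rad" for x
  proof (rule radI)
    fix y
    have "t ((x \<odot> e) \<odot> y) = t (e \<odot> (y \<odot> x))"
      using t_assoc[of x e y] t_comm[of x] t_assoc[of e y x] by simp
    then show "t ((x \<odot> e - x) \<odot> y) = 0"
      by (simp add: mult_diff t_diff e t_comm[of x])
  qed
  ultimately show ?thesis using e by (intro exI[of _ e]) simp
qed

end

subsection \<open>Leibniz-derivations\<close>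

context alternative_algebra
begin

abbreviation word :: "'v list \<Rightarrow> 'v \<Rightarrow> 'v"
  where "word xs y \<equiv> foldl (\<odot>) y xs"

text \<open>The formal derivative of \<open>word xs\<close>. For a Leibniz-derivation of order
  \<open>Suc (length xs)\<close> it is the commutator of \<open>\<phi>\<close> with
  \<open>word xs\<close>, the argument \<open>y\<close> being the first factor.\<close>

definition dword :: "('v \<Rightarrow> 'v) \<Rightarrow> 'v list \<Rightarrow> 'v \<Rightarrow> 'v"
  where "dword \<phi> xs y = (\<Sum>i<length xs. word (xs[i := \<phi> (xs ! i)]) y)"

lemma dword_Nil: "dword \<phi> [] = (\<lambda>y. 0)"
  by (simp add: dword_def fun_eq_iff)

lemma dword_Cons: "dword \<phi> (x # xs) = (\<lambda>y. word xs (y \<odot> \<phi> x) + dword \<phi> xs (y \<odot> x))"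
  unfolding dword_def by (simp add: sum.lessThan_Suc_shift fun_eq_iff del: sum.lessThan_Suc)

lemma endo_word: "endo (word xs)"
proof (induction xs)
  case (Cons x xs)
  then show ?case using endo_comp[OF Cons endo_R] by simp
qed (simp add: endoI)

lemma dword_snoc: "dword \<phi> (xs @ [x]) = (\<lambda>y. dword \<phi> xs y \<odot> x + word xs y \<odot> \<phi> x)"
  by (induction xs) (simp_all add: dword_Cons dword_Nil mult_add mult_zero add.assoc)

text \<open>A relation rather than a function: \<open>V'\<close> is attached to an expression of
  \<open>V\<close> as a sum of words of length \<open>m\<close>, and different expressions of
  \<open>V\<close> may have different derivatives.\<close>

inductive leibniz_pair :: "('v \<Rightarrow> 'v) \<Rightarrow> nat \<Rightarrow> ('v \<Rightarrow> 'v) \<Rightarrow> ('v \<Rightarrow> 'v) \<Rightarrow> bool" for \<phi> where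
  word: "leibniz_pair \<phi> (length xs) (word xs) (dword \<phi> xs)"
| add: "leibniz_pair \<phi> m V V' \<Longrightarrow> leibniz_pair \<phi> m W W' \<Longrightarrow>
    leibniz_pair \<phi> m (\<lambda>y. V y + W y) (\<lambda>y. V' y + W' y)"

lemma leibniz_pair_single: "leibniz_pair \<phi> 1 (R x) (R (\<phi> x))"
  using leibniz_pair.word[of \<phi> "[x]"] by (simp add: dword_Cons dword_Nil)

lemma leibniz_pair_after:
  "leibniz_pair \<phi> m V V' \<Longrightarrow> leibniz_pair \<phi> (Suc m) (\<lambda>y. V y \<odot> x) (\<lambda>y. V' y \<odot> x + V y \<odot> \<phi> x)"
proof (induction rule: leibniz_pair.induct)
  case (word xs)
  show ?case using leibniz_pair.word[of \<phi> "xs @ [x]"] by (simp add: dword_snoc)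
next
  case (add m V V' W W')
  show ?case using leibniz_pair.add[OF add.IH] by (simp add: mult_add algebra_simps)
qed

lemma leibniz_pair_before:
  "leibniz_pair \<phi> m V V' \<Longrightarrow> leibniz_pair \<phi> (Suc m) (\<lambda>y. V (y \<odot> x)) (\<lambda>y. V (y \<odot> \<phi> x) + V' (y \<odot> x))"
proof (induction rule: leibniz_pair.induct)
  case (word xs)
  show ?case using leibniz_pair.word[of \<phi> "x # xs"] by (simp add: dword_Cons)
next
  case (add m V V' W W')
  show ?case using leibniz_pair.add[OF add.IH] by (simp add: algebra_simps)
qed

text \<open>The operators \<open>R x\<close> are closed under the symmetrized product, which produces from words
  of any length \<open>m\<close> an operator \<open>R z\<close> whose derivative is again a right multiplication.\<close>

lemma leibniz_pair_R:
  assumes e: "\<And>x. e \<odot> x - x \<in> rad" "\<And>x. x \<odot> e - x \<in> rad"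
  shows "\<exists>z z'. leibniz_pair \<phi> (Suc m) (R z) (R z') \<and> z - (2 ^ m) *s y \<in> rad"
proof (induction m)
  case 0
  show ?case
    using leibniz_pair_single[of \<phi> y] subspace_0[OF subspace_rad]
    by (intro exI[of _ y] exI[of _ "\<phi> y"]) simp
next
  case (Suc m)
  then obtain z z' where z: "leibniz_pair \<phi> (Suc m) (R z) (R z')" "z - (2 ^ m) *s y \<in> rad" by blast
  \<comment> \<open>\<open>?z'\<close> is the product rule applied to \<open>?z\<close>, with
    \<open>z'\<close> in the role of the derivative of \<open>z\<close>. Modulo \<open>rad\<close>
    the symmetrization with \<open>e\<close> doubles \<open>z\<close>, whence the factor
    \<open>2 ^ m\<close>.\<close>
  let ?z = "e \<odot> z + z \<odot> e" and ?z' = "\<phi> e \<odot> z + z \<odot> \<phi> e + (e \<odot> z' + z' \<odot> e)"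
  have "R ?z = (\<lambda>y. y \<odot> z \<odot> e + y \<odot> e \<odot> z)"
    by (rule ext) (rule R_jordan)
  moreover have "y \<odot> ?z' = y \<odot> z' \<odot> e + y \<odot> z \<odot> \<phi> e + (y \<odot> \<phi> e \<odot> z + y \<odot> e \<odot> z')" for y
    unfolding mult_add(1)[of y "\<phi> e \<odot> z + z \<odot> \<phi> e"] R_jordan by (simp add: add_ac)
  ultimately have "leibniz_pair \<phi> (Suc (Suc m)) (R ?z) (R ?z')"
    using leibniz_pair.add[OF leibniz_pair_after[OF z(1), of e] leibniz_pair_before[OF z(1), of e]]
    by presburger
  moreover have "?z - (2 ^ Suc m) *s y \<in> rad"
  proof -
    have "?z - (2 ^ Suc m) *s y = (e \<odot> z - z) + (z \<odot> e - z) + 2 *s (z - (2 ^ m) *s y)"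
      by (simp add: algebra_simps scale_2[symmetric])
    then show ?thesis
      using e z(2) by (simp only:) (intro subspace_add subspace_scale subspace_rad e z(2))
  qed
  ultimately show ?case by blast
qed

lemma leibniz_derivation_word:
  assumes "leibniz_derivation scale mult (Suc (length xs)) \<phi>"
  shows "\<phi> (word xs y) = word xs (\<phi> y) + dword \<phi> xs y"
proof -
  have "\<phi> (lnprod mult (y # xs)) =
      (\<Sum>i<Suc (length xs). lnprod mult ((y # xs)[i := \<phi> ((y # xs) ! i)]))"
    using assms unfolding leibniz_derivation_def by (metis length_Cons)
  then show ?thesis
    unfolding dword_def by (simp add: sum.lessThan_Suc_shift fun_eq_iff del: sum.lessThan_Suc)
qed

text \<open>For a word the derivative is a commutator with \<open>\<phi>\<close>, hence has trace
  zero; sums follow.\<close>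

lemma leibniz_pair_trace:
  assumes "leibniz_derivation scale mult n \<phi>" "n = Suc m" "leibniz_pair \<phi> m V V'"
  shows "tr V' = 0"
  using assms(3,2)
proof (induction rule: leibniz_pair.induct)
  case (word xs)
  have \<phi>: "endo \<phi>" using assms(1) by (simp add: leibniz_derivation_def)
  have "dword \<phi> xs y = \<phi> (word xs y) - word xs (\<phi> y)" for y
    using leibniz_derivation_word[of xs \<phi> y] assms(1) word by simp
  then have "tr (dword \<phi> xs) = tr (\<lambda>y. \<phi> (word xs y) - word xs (\<phi> y))"
    by presburger
  also have "\<dots> = 0"
    using tr_comm[OF \<phi> endo_word[of xs]] by (subst tr_diff) simp
  finally show ?case .
next
  case (add m V V' W W')
  then show ?case by (simp add: tr_add)
qed

text \<open>Words of length \<open>m + 2\<close> have room for \<open>u\<close> as first letter and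
  for \<open>m + 1\<close> letters symmetrized into \<open>R z\<close>, where \<open>z\<close> is
  \<open>2 ^ m\<close> times \<open>y\<close> modulo \<open>rad\<close>. The derivative has trace
  \<open>t (\<phi> u \<odot> z) + t (u \<odot> z') = 0\<close>, and the second term
  vanishes.\<close>

lemma rad_invariant:
  assumes "leibniz_derivation scale mult (Suc (Suc (Suc m))) \<phi>" and u: "u \<in> rad"
  shows "\<phi> u \<in> rad"
proof (rule radI)
  fix y
  obtain e where e: "\<And>x. e \<odot> x - x \<in> rad" "\<And>x. x \<odot> e - x \<in> rad"
    using unit_mod_rad by blast
  obtain z z' where z: "leibniz_pair \<phi> (Suc m) (R z) (R z')" "z - (2 ^ m) *s y \<in> rad"
    using leibniz_pair_R[OF e] by blast
  have "0 = tr (\<lambda>y. y \<odot> \<phi> u \<odot> z + y \<odot> u \<odot> z')"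
    using leibniz_pair_trace[OF assms(1) refl leibniz_pair_before[OF z(1)]] by simp
  also have "\<dots> = t (\<phi> u \<odot> z) + t (u \<odot> z')"
    unfolding t_mult by (rule tr_add)
  finally have "t (\<phi> u \<odot> z) = 0"
    using u by (simp add: radD)
  moreover have "t (\<phi> u \<odot> (z - (2 ^ m) *s y)) = 0"
    using z(2) by (rule radD)
  ultimately show "t (\<phi> u \<odot> y) = 0"
    by (simp add: mult_diff mult_scale t_diff t_scale)
qed

lemma rad_eq_UNIV:
  assumes \<phi>: "leibniz_derivation scale mult n \<phi>" "n \<ge> 2" "bij \<phi>"
  shows "rad = UNIV"
proof (cases "n = 2")
  case True
  \<comment> \<open>At order 2 the words are single letters: \<open>R (\<phi> u)\<close> is itself a
    commutator with \<open>\<phi>\<close>, and \<open>\<phi>\<close> is onto.\<close>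
  have "t (\<phi> u) = 0" for u
    using leibniz_pair_trace[OF \<phi>(1), of 1] leibniz_pair_single[of \<phi> u] True by (simp add: t_def)
  then have "t x = 0" for x
    using \<phi>(3) by (metis bij_pointE)
  then show ?thesis by (auto simp: rad_def)
next
  case False
  define m where "m = n - 3"
  have n: "n = Suc (Suc (Suc m))" using False \<phi>(2) by (simp add: m_def)
  have endo: "endo \<phi>" using \<phi>(1) by (simp add: leibniz_derivation_def)
  have inv: "\<phi> x \<in> rad" if "x \<in> rad" for x
    by (rule rad_invariant[OF \<phi>(1)[unfolded n] that])
  interpret pair: finite_dimensional_vector_space_pair_1 scale Basis scale
    by unfold_locales
  have "inj_on \<phi> (span rad)"
    using \<phi>(3) bij_betw_imp_inj_on inj_on_subset by blast
  then have "dim (\<phi> ` rad) = dim rad"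
    by (rule pair.dim_image_eq[OF endo])
  \<comment> \<open>Equality, together with injectivity of \<open>\<phi>\<close>, later pulls
    \<open>\<phi> e \<in> rad\<close> back to \<open>e \<in> rad\<close>.\<close>
  then have image: "\<phi> ` rad = rad"
    using inv endo subspace_rad by (intro subspace_dim_equal subspace_endo_image) auto
  obtain e where e: "\<And>x. t x = t (e \<odot> x)" "\<And>x. e \<odot> x - x \<in> rad" "\<And>x. x \<odot> e - x \<in> rad"
    using unit_mod_rad by blast
  have word_e: "word (replicate k e) v - v \<in> rad" for k v
  proof (induction k arbitrary: v)
    case (Suc k)
    have "word (replicate k e) (v \<odot> e) - v = (word (replicate k e) (v \<odot> e) - v \<odot> e) + (v \<odot> e - v)"
      by simp
    also have "\<dots> \<in> rad" by (intro subspace_add subspace_rad Suc e)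
    finally show ?case by simp
  qed (simp add: subspace_0 subspace_rad)
  define a where "a = \<phi> e"
  have dword_e: "dword \<phi> (replicate k e) v - of_nat k *s (v \<odot> a) \<in> rad" for k v
  proof (induction k arbitrary: v)
    case (Suc k)
    have "dword \<phi> (replicate (Suc k) e) v - of_nat (Suc k) *s (v \<odot> a) =
      (word (replicate k e) (v \<odot> a) - v \<odot> a) +
      (dword \<phi> (replicate k e) (v \<odot> e) - of_nat k *s (v \<odot> e \<odot> a)) + of_nat k *s ((v \<odot> e - v) \<odot> a)"
      by (simp add: dword_Cons a_def[symmetric] mult_diff algebra_simps)
    also have "\<dots> \<in> rad"
      by (intro subspace_add subspace_scale subspace_rad Suc e rad_mult word_e)
    finally show ?case .
  qed (simp add: dword_Nil subspace_0 subspace_rad)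
  let ?r = "replicate (Suc (Suc m)) e" and ?k = "of_nat (Suc (Suc m)) :: 'k"
  \<comment> \<open>Modulo \<open>rad\<close> the left side is \<open>a\<close>, because
    \<open>word ?r e\<close> is \<open>e\<close> and \<open>rad\<close> is invariant, while the
    right side is \<open>a\<close> plus \<open>?k\<close> times \<open>a\<close>. Here
    \<open>?k\<close> is \<open>n - 1\<close>, nonzero in characteristic zero.\<close>
  have "\<phi> (word ?r e) = word ?r a + dword \<phi> ?r e"
    using leibniz_derivation_word[of ?r \<phi> e] \<phi>(1) by (simp add: n a_def)
  then have "?k *s a = \<phi> (word ?r e - e) - (word ?r a - a) - (dword \<phi> ?r e - ?k *s (e \<odot> a))
      - ?k *s (e \<odot> a - a)"
    by (simp add: endo_diff[OF endo] a_def algebra_simps del: of_nat_Suc replicate.simps)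
  also have "\<dots> \<in> rad"
    by (intro subspace_diff subspace_scale subspace_rad inv word_e dword_e e)
  finally have "inverse ?k *s (?k *s a) \<in> rad"
    by (rule subspace_scale[OF subspace_rad])
  then have "a \<in> rad"
    by (simp del: of_nat_Suc)
  then have "e \<in> rad"
    using image \<phi>(3) unfolding a_def bij_def inj_def by (metis imageE)
  then have "t x = 0" for x
    using e(1) radD by metis
  then show ?thesis by (auto simp: rad_def)
qed

end

subsection \<open>Nil algebras are nilpotent\<close>

context finite_dimensional_vector_space
begin

definition op_span :: "('b \<Rightarrow> 'b) set \<Rightarrow> 'b set \<Rightarrow> 'b set"
  where "op_span P U = span {f u | f u. f \<in> P \<and> u \<in> U}"

text \<open>For linear operators: some \<open>n\<close> exists such that every composition of
  \<open>n\<close> members of \<open>P\<close> is zero.\<close>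

definition nil_ops :: "('b \<Rightarrow> 'b) set \<Rightarrow> bool"
  where "nil_ops P \<longleftrightarrow> (\<exists>n. (op_span P ^^ n) UNIV \<subseteq> {0})"

lemma op_spanI: "f \<in> P \<Longrightarrow> u \<in> U \<Longrightarrow> f u \<in> op_span P U"
  unfolding op_span_def by (rule span_base) blast

lemma op_span_least:
  "subspace W \<Longrightarrow> (\<And>f u. f \<in> P \<Longrightarrow> u \<in> U \<Longrightarrow> f u \<in> W) \<Longrightarrow> op_span P U \<subseteq> W"
  unfolding op_span_def by (rule span_minimal) blast

lemma subspace_op_span: "subspace (op_span P U)"
  by (simp add: op_span_def)

lemma mono_op_span: "mono (op_span P)"
  by (rule monoI) (metis op_spanI op_span_least subspace_op_span subset_iff)

lemma funpow_op_span_mono: "U \<subseteq> W \<Longrightarrow> (op_span P ^^ n) U \<subseteq> (op_span P ^^ n) W"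
  by (rule funpow_mono[OF mono_op_span])

lemma subspace_funpow_op_span: "subspace U \<Longrightarrow> subspace ((op_span P ^^ n) U)"
  by (cases n) (simp_all add: subspace_op_span)

lemma funpow_op_span_antimono: "(op_span P ^^ Suc n) UNIV \<subseteq> (op_span P ^^ n) UNIV"
  using funpow_op_span_mono[of "op_span P UNIV" UNIV n P] by (simp add: funpow_swap1)

text \<open>The subspaces \<open>V j\<close> of the descending chain of \<open>P\<close> are invariant under \<open>Q\<close>, and modulo
  \<open>V (Suc j)\<close> only \<open>Q\<close> acts on \<open>V j\<close>.\<close>

lemma nil_ops_Un:
  assumes P: "nil_ops P" and Q: "nil_ops Q"
    and endo: "\<And>f. f \<in> P \<union> Q \<Longrightarrow> endo f"
    and comm: "\<And>f g u. f \<in> P \<Longrightarrow> g \<in> Q \<Longrightarrow>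
      g (f u) \<in> span ({f' (g' u) | f' g'. f' \<in> P \<and> g' \<in> Q} \<union> {f' u | f'. f' \<in> P})"
  shows "nil_ops (P \<union> Q)"
proof -
  obtain p q where p: "(op_span P ^^ p) UNIV \<subseteq> {0}" and q: "(op_span Q ^^ q) UNIV \<subseteq> {0}"
    using P Q by (auto simp: nil_ops_def)
  define V where "V j = (op_span P ^^ j) UNIV" for j
  have V_Suc: "V (Suc j) = op_span P (V j)" for j by (simp add: V_def)
  have sub: "subspace (V j)" for j
    unfolding V_def by (rule subspace_funpow_op_span) simp
  have anti: "V (Suc j) \<subseteq> V j" for j
    unfolding V_def by (rule funpow_op_span_antimono)
  \<comment> \<open>\<open>comm\<close> moves \<open>g\<close> past \<open>f\<close>, leaving terms
    \<open>f' (g' u)\<close> and \<open>f' u\<close>; both lie in \<open>V (Suc j)\<close> once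
    \<open>V j\<close> is invariant.\<close>
  have inv: "g v \<in> V j" if "g \<in> Q" "v \<in> V j" for g v j
    using that
  proof (induction j arbitrary: g v)
    case 0
    then show ?case by (simp add: V_def)
  next
    case (Suc j)
    have "op_span P (V j) \<subseteq> {v. g v \<in> V (Suc j)}"
    proof (rule op_span_least)
      show "subspace {v. g v \<in> V (Suc j)}"
        using Suc.prems endo sub by (intro subspace_endo_vimage) auto
      fix f u assume fu: "f \<in> P" "u \<in> V j"
      have "span ({f' (g' u) | f' g'. f' \<in> P \<and> g' \<in> Q} \<union> {f' u | f'. f' \<in> P}) \<subseteq> V (Suc j)"
        unfolding V_Suc using Suc.IH fu(2) by (intro span_minimal subspace_op_span) (auto intro: op_spanI)
      then show "f u \<in> {v. g v \<in> V (Suc j)}"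
        using comm[OF fu(1) Suc.prems(1)] by auto
    qed
    then show ?case using Suc.prems by (auto simp: V_Suc)
  qed
  have QV: "(op_span Q ^^ i) (V j) \<subseteq> V j" for i j
  proof (induction i)
    case (Suc i)
    have "op_span Q ((op_span Q ^^ i) (V j)) \<subseteq> V j"
      using Suc inv by (intro op_span_least sub) blast
    then show ?case by simp
  qed simp
  have step: "(op_span (P \<union> Q) ^^ i) (V j) \<subseteq> span (V (Suc j) \<union> (op_span Q ^^ i) (V j))" for i j
  proof (induction i)
    case 0
    then show ?case by (auto intro: span_base)
  next
    case (Suc i)
    let ?W = "span (V (Suc j) \<union> (op_span Q ^^ Suc i) (V j))"
    have "h u \<in> ?W" if h: "h \<in> P \<union> Q" and u: "u \<in> (op_span (P \<union> Q) ^^ i) (V j)" for h u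
    proof -
      have "span (V (Suc j) \<union> (op_span Q ^^ i) (V j)) \<subseteq> {u. h u \<in> ?W}"
      proof (rule span_minimal)
        show "subspace {u. h u \<in> ?W}"
          using h endo by (intro subspace_endo_vimage) auto
        have "h u \<in> V (Suc j)" if "u \<in> V (Suc j)" for u
          using h inv[of h u "Suc j"] that anti[of j] op_spanI[of h P u "V j"]
          by (auto simp: V_Suc[symmetric])
        moreover have "h u \<in> V (Suc j) \<union> (op_span Q ^^ Suc i) (V j)" if "u \<in> (op_span Q ^^ i) (V j)" for u
          using h that QV[of i j] by (auto simp: V_Suc intro: op_spanI)
        ultimately show "V (Suc j) \<union> (op_span Q ^^ i) (V j) \<subseteq> {u. h u \<in> ?W}"
          by (auto intro!: span_base)
      qed
      then show ?thesis using u Suc.IH by blast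
    qed
    then have "op_span (P \<union> Q) ((op_span (P \<union> Q) ^^ i) (V j)) \<subseteq> ?W"
      by (intro op_span_least subspace_span)
    then show ?case by simp
  qed
  \<comment> \<open>After \<open>q\<close> steps the part produced by \<open>Q\<close> alone is
    zero, so \<open>q\<close> steps descend one level and \<open>q * p\<close> steps reach
    zero.\<close>
  have drop: "(op_span (P \<union> Q) ^^ q) (V j) \<subseteq> V (Suc j)" for j
  proof -
    have "(op_span Q ^^ q) (V j) \<subseteq> {0}"
      using funpow_op_span_mono[of "V j" UNIV q Q] q by auto
    then have "V (Suc j) \<union> (op_span Q ^^ q) (V j) \<subseteq> V (Suc j)"
      using subspace_0[OF sub] by auto
    then have "span (V (Suc j) \<union> (op_span Q ^^ q) (V j)) \<subseteq> V (Suc j)"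
      using sub by (intro span_minimal)
    then show ?thesis using step[of q j] by simp
  qed
  have "((op_span (P \<union> Q) ^^ q) ^^ j) UNIV \<subseteq> V j" for j
  proof (induction j)
    case (Suc j)
    have "((op_span (P \<union> Q) ^^ q) ^^ Suc j) UNIV \<subseteq> (op_span (P \<union> Q) ^^ q) (V j)"
      using funpow_op_span_mono[OF Suc] by simp
    then show ?case using drop by blast
  qed (simp add: V_def)
  from this[of p] have "(op_span (P \<union> Q) ^^ (q * p)) UNIV \<subseteq> {0}"
    using p by (simp add: funpow_mult V_def)
  then show ?thesis by (auto simp: nil_ops_def)
qed

text \<open>Lets the multiplications by a spanning set stand for those by the whole span.\<close>

lemma nil_ops_combination:
  assumes "nil_ops P" "\<And>h u. h \<in> P' \<Longrightarrow> h u \<in> span {f u | f. f \<in> P}"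
  shows "nil_ops P'"
proof -
  have sub: "op_span P' U \<subseteq> op_span P U" for U
  proof (rule op_span_least[OF subspace_op_span])
    fix h u assume "h \<in> P'" "u \<in> U"
    then have "h u \<in> span {f u | f. f \<in> P}" using assms(2) by blast
    also have "\<dots> \<subseteq> op_span P U"
      using \<open>u \<in> U\<close> by (intro span_minimal subspace_op_span) (auto intro: op_spanI)
    finally show "h u \<in> op_span P U" .
  qed
  have "(op_span P' ^^ n) UNIV \<subseteq> (op_span P ^^ n) UNIV" for n
  proof (induction n)
    case (Suc n)
    have "op_span P' ((op_span P' ^^ n) UNIV) \<subseteq> op_span P' ((op_span P ^^ n) UNIV)"
      using monoD[OF mono_op_span Suc] .
    then show ?case using sub by auto
  qed simp
  then show ?thesis using assms(1) unfolding nil_ops_def by blast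
qed

lemma nil_ops_single:
  assumes "endo f" "\<And>x. (f ^^ m) x = 0"
  shows "nil_ops {f}"
proof -
  have "(op_span {f} ^^ n) UNIV \<subseteq> range (f ^^ n)" for n
  proof (induction n)
    case (Suc n)
    then have "op_span {f} ((op_span {f} ^^ n) UNIV) \<subseteq> range (f ^^ Suc n)"
      by (intro op_span_least subspace_endo_image endo_funpow assms(1)) auto
    then show ?case by simp
  qed simp
  from this[of m] show ?thesis using assms(2) by (auto simp: nil_ops_def)
qed

end

context alternative_algebra
begin

definition mults :: "'v set \<Rightarrow> ('v \<Rightarrow> 'v) set"
  where "mults S = mult ` S \<union> R ` S"

text \<open>Left and right multiplication by \<open>y\<close> commute by the flexible law, so
  together they act nilpotently. They are then joined to the multiplications by \<open>S\<close>,
  which they normalize in the sense of \<open>nil_ops_Un\<close>; linear combinations cover the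
  span.\<close>

lemma nil_ops_extend:
  assumes S: "subspace S" "nil_ops (mults S)"
    and y: "\<And>b. b \<in> S \<Longrightarrow> y \<odot> b \<in> S \<and> b \<odot> y \<in> S"
    and nil: "\<And>z. (R y ^^ m) z = 0" "\<And>z. (mult y ^^ m') z = 0"
  shows "nil_ops (mults (span (insert y S)))"
proof (rule nil_ops_combination)
  have LR: "nil_ops ({mult y} \<union> {R y})"
  proof (rule nil_ops_Un)
    show "nil_ops {mult y}" "nil_ops {R y}"
      using nil nil_ops_single endo_L endo_R by blast+
    have "assoc y u y = 0" for u
      using assoc_swap12[of y u y] alt by (simp add: alternative_def)
    then have "y \<odot> u \<odot> y = y \<odot> (u \<odot> y)" for u
      by (simp add: assoc3_def)
    then show "g (f u) \<in> span ({f' (g' u) | f' g'. f' \<in> {mult y} \<and> g' \<in> {R y}} \<union> {f' u | f'. f' \<in> {mult y}})"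
      if "f \<in> {mult y}" "g \<in> {R y}" for f g u
      using that by (auto intro: span_base)
  qed (auto intro: endo_L endo_R)
  show "nil_ops (mults S \<union> ({mult y} \<union> {R y}))"
  proof (rule nil_ops_Un[OF S(2) LR])
    show "endo f" if "f \<in> mults S \<union> ({mult y} \<union> {R y})" for f
      using that endo_L endo_R by (auto simp: mults_def)
    fix f g u assume f: "f \<in> mults S" and g: "g \<in> {mult y} \<union> {R y}"
    let ?X = "{f' (g' u) | f' g'. f' \<in> mults S \<and> g' \<in> {mult y} \<union> {R y}} \<union> {f' u | f'. f' \<in> mults S}"
    from f obtain b where b: "b \<in> S" "f = mult b \<or> f = R b" by (auto simp: mults_def)
    have S': "y \<odot> b \<in> S" "b \<odot> y \<in> S" using y b by auto
    have twice: "f' (g' u) \<in> span ?X" if "f' \<in> mults S" "g' \<in> {mult y} \<union> {R y}" for f' g'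
      using that by (intro span_base UnI1 CollectI exI[of _ f'] exI[of _ g']) simp
    have once: "f' u \<in> span ?X" if "f' \<in> mults S" for f'
      using that by (intro span_base) blast
    have mem: "c \<odot> (y \<odot> u) \<in> span ?X" "c \<odot> (u \<odot> y) \<in> span ?X" "(y \<odot> u) \<odot> c \<in> span ?X"
      "(u \<odot> y) \<odot> c \<in> span ?X" "c \<odot> u \<in> span ?X" "u \<odot> c \<in> span ?X" if "c \<in> S" for c
      using that twice[of "mult c" "mult y"] twice[of "mult c" "R y"] twice[of "R c" "mult y"]
        twice[of "R c" "R y"] once[of "mult c"] once[of "R c"]
      by (simp_all add: mults_def)
    \<comment> \<open>The four ways to multiply by \<open>y\<close> after multiplying by
      \<open>b\<close>. On the right sides the outermost multiplication is by an element of
      \<open>S\<close>: by \<open>b\<close>, or by one of the products of \<open>b\<close> and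
      \<open>y\<close>.\<close>
    have 1: "(b \<odot> u) \<odot> y = b \<odot> (u \<odot> y) - (b \<odot> y) \<odot> u + b \<odot> (y \<odot> u)"
      using assoc_swap23[of b y u] by (simp add: assoc3_def algebra_simps)
    have 2: "y \<odot> (u \<odot> b) = (y \<odot> u) \<odot> b + (u \<odot> y) \<odot> b - u \<odot> (y \<odot> b)"
      using assoc_swap12[of y u b] by (simp add: assoc3_def algebra_simps)
    have 3: "(u \<odot> b) \<odot> y = u \<odot> (b \<odot> y) + u \<odot> (y \<odot> b) - (u \<odot> y) \<odot> b"
      using R_jordan[of u b y] by (simp add: mult_add algebra_simps)
    have 4: "y \<odot> (b \<odot> u) = (b \<odot> y) \<odot> u + (y \<odot> b) \<odot> u - b \<odot> (y \<odot> u)"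
      using L_jordan[of b y u] by (simp add: mult_add algebra_simps)
    have "(b \<odot> u) \<odot> y \<in> span ?X" "y \<odot> (u \<odot> b) \<in> span ?X" "(u \<odot> b) \<odot> y \<in> span ?X" "y \<odot> (b \<odot> u) \<in> span ?X"
      unfolding 1 2 3 4 by (intro span_add span_diff mem b(1) S')+
    then show "g (f u) \<in> span ?X"
      using b(2) g by auto
  qed
  fix h u assume h: "h \<in> mults (span (insert y S))"
  let ?Y = "{f u | f. f \<in> mults S \<union> ({mult y} \<union> {R y})}"
  from h obtain a where a: "a \<in> span (insert y S)" "h = mult a \<or> h = R a" by (auto simp: mults_def)
  then obtain k where "a - k *s y \<in> span S"
    using span_breakdown_eq by blast
  then have s: "a - k *s y \<in> S" using S(1) by (metis span_eq_iff)
  have once: "f u \<in> span ?Y" if "f \<in> mults S \<union> ({mult y} \<union> {R y})" for f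
    using that by (intro span_base CollectI exI[of _ f]) simp
  have "(a - k *s y) \<odot> u \<in> span ?Y" "u \<odot> (a - k *s y) \<in> span ?Y" "y \<odot> u \<in> span ?Y" "u \<odot> y \<in> span ?Y"
    using s once[of "mult (a - k *s y)"] once[of "R (a - k *s y)"] once[of "mult y"] once[of "R y"]
    by (simp_all add: mults_def)
  then have "(a - k *s y) \<odot> u + k *s (y \<odot> u) \<in> span ?Y" "u \<odot> (a - k *s y) + k *s (u \<odot> y) \<in> span ?Y"
    by (auto intro: span_add span_scale)
  then show "h u \<in> span ?Y"
    using a(2) by (auto simp: mult_diff mult_scale)
qed

lemma subalgebra_extend:
  assumes S: "subspace S" "\<And>a b. a \<in> S \<Longrightarrow> b \<in> S \<Longrightarrow> a \<odot> b \<in> S"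
    and y: "\<And>b. b \<in> S \<Longrightarrow> y \<odot> b \<in> S \<and> b \<odot> y \<in> S" "y \<odot> y \<in> S"
    and ab: "a \<in> span (insert y S)" "b \<in> span (insert y S)"
  shows "a \<odot> b \<in> span (insert y S)"
proof -
  have "\<exists>k s. s \<in> S \<and> c = k *s y + s" if "c \<in> span (insert y S)" for c
  proof -
    from that obtain k where "c - k *s y \<in> span S"
      using span_breakdown_eq by blast
    then have "c - k *s y \<in> S" using S(1) by (metis span_eq_iff)
    then show ?thesis by (intro exI[of _ k] exI[of _ "c - k *s y"]) simp
  qed
  then obtain k s l r where s: "s \<in> S" "a = k *s y + s" and r: "r \<in> S" "b = l *s y + r"
    using ab by metis
  have "a \<odot> b = k *s (l *s (y \<odot> y)) + l *s (s \<odot> y) + (k *s (y \<odot> r) + s \<odot> r)"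
    by (simp add: s r mult_add mult_scale algebra_simps)
  also have "\<dots> \<in> S"
    using y(1)[OF s(1)] y(1)[OF r(1)] y(2) S(2)[OF s(1) r(1)]
    by (simp add: subspace_add subspace_scale S(1))
  finally show ?thesis by (simp add: span_base)
qed

text \<open>A subalgebra of maximal dimension among those acting nilpotently is everything: otherwise
  the last nonzero step of the chain yields some \<open>x\<close> outside with \<open>x S\<close> and \<open>S x\<close> inside, and the
  last power of \<open>x\<close> outside can be adjoined.\<close>

lemma nil_imp_nil_ops:
  assumes nil: "\<And>x. \<exists>m. \<forall>z. (R x ^^ m) z = 0"
  shows "nil_ops (mults UNIV)"
proof -
  define good where "good S \<longleftrightarrow> subspace S \<and> (\<forall>a\<in>S. \<forall>b\<in>S. a \<odot> b \<in> S) \<and> nil_ops (mults S)" for S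
  have "mults {0} = {\<lambda>z. 0}"
    by (auto simp: mults_def mult_zero fun_eq_iff)
  then have "nil_ops (mults {0})"
    using nil_ops_single[of "\<lambda>z. 0" 1] endo_const_zero by simp
  then have "good {0}"
    by (simp add: good_def mult_zero)
  then obtain S where S: "good S" "\<And>T. good T \<Longrightarrow> dim T \<le> dim S"
    using ex_has_greatest_nat[of good "{0}" dim "Suc dimension"] dim_subset_UNIV
    by (auto simp: less_Suc_eq_le)
  have S': "subspace S" "\<And>a b. a \<in> S \<Longrightarrow> b \<in> S \<Longrightarrow> a \<odot> b \<in> S" "nil_ops (mults S)"
    using S(1) by (auto simp: good_def)
  have "S = UNIV"
  proof (rule ccontr)
    assume "S \<noteq> UNIV"
    define V where "V j = (op_span (mults S) ^^ j) UNIV" for j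
    obtain p where "V p \<subseteq> {0}"
      using S'(3) by (auto simp: nil_ops_def V_def)
    then have "V p \<subseteq> S" using subspace_0[OF S'(1)] by auto
    moreover have "\<not> V 0 \<subseteq> S" using \<open>S \<noteq> UNIV\<close> by (auto simp: V_def)
    \<comment> \<open>\<open>V (Suc k)\<close> is the first member of the chain inside
      \<open>S\<close>, so multiplying an element of \<open>V k\<close> by \<open>S\<close> on
      either side lands in \<open>S\<close>.\<close>
    ultimately obtain k where k: "V (Suc k) \<subseteq> S" "\<forall>i\<le>k. \<not> V i \<subseteq> S"
      using ex_least_nat_less[of "\<lambda>j. V j \<subseteq> S" p] by blast
    then obtain x where x: "x \<in> V k" "x \<notin> S" by blast
    have xS: "x \<odot> b \<in> S" "b \<odot> x \<in> S" if "b \<in> S" for b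
      using k(1) x(1) that op_spanI[of "mult b" "mults S" x "V k"] op_spanI[of "R b" "mults S" x "V k"]
      by (auto simp: V_def mults_def)
    obtain m where m: "\<And>z. (R x ^^ m) z = 0" using nil by blast
    have "i < m" if "pow x i \<notin> S" for i
    proof (rule ccontr)
      assume "\<not> i < m"
      then have "pow x i = (R x ^^ m) ((R x ^^ (i - m)) x)"
        unfolding pow_def by (simp add: funpow_add[symmetric, THEN fun_cong, simplified o_apply])
      then show False using that m subspace_0[OF S'(1)] by simp
    qed
    then obtain i where i: "pow x i \<notin> S" "\<And>j. pow x j \<notin> S \<Longrightarrow> j \<le> i"
      using ex_has_greatest_nat[of "\<lambda>i. pow x i \<notin> S" 0 "\<lambda>i. i" m] x(2) by auto
    define y where "y = pow x i"
    have "(R x ^^ j) b \<in> S" "(mult x ^^ j) b \<in> S" if "b \<in> S" for b j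
      using that xS by (induction j) auto
    then have yS: "y \<odot> b \<in> S \<and> b \<odot> y \<in> S" if "b \<in> S" for b
      using that unfolding y_def mult_pow by blast
    \<comment> \<open>The square of \<open>y\<close> is a power of \<open>x\<close> of index
      \<open>2 i + 1\<close>, beyond the last index \<open>i\<close> outside
      \<open>S\<close>.\<close>
    have yy: "y \<odot> y \<in> S"
      using i(2)[of "Suc (i + i)"] unfolding y_def pow_mult_pow by force
    obtain n where n: "\<And>z. (R y ^^ n) z = 0" using nil by blast
    \<comment> \<open>Nilpotency on the left follows from the right: \<open>R y ^^ n\<close> applied
      to \<open>y\<close> is \<open>pow y n\<close>, which is therefore zero.\<close>
    then have "(mult y ^^ Suc n) z = 0" for z
      unfolding mult_pow(2)[symmetric] by (simp add: pow_def mult_zero)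
    then have "nil_ops (mults (span (insert y S)))"
      using nil_ops_extend[OF S'(1,3) yS n] by blast
    then have "good (span (insert y S))"
      using subalgebra_extend[OF S'(1,2) yS yy] by (simp add: good_def)
    then have "dim (span (insert y S)) \<le> dim S" by (rule S(2))
    then have "S = span (insert y S)"
      using S'(1) by (intro subspace_dim_equal subspace_span) (auto intro: span_base)
    then have "y \<in> S" using span_base[of y "insert y S"] by blast
    then show False using i(1) by (simp add: y_def)
  qed
  then show ?thesis using S'(3) by simp
qed

text \<open>In a product of at least \<open>2 ^ k\<close> factors with \<open>k > 0\<close>, one of
  the two outer parts has at least half as many. Following that part \<open>k\<close> times shows
  the product as \<open>k\<close> successive multiplications, hence in \<open>V k\<close>.\<close>

lemma nil_ops_imp_nilpotent:
  assumes "nil_ops (mults UNIV)"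
  shows "nilpotent_alg mult"
proof -
  define V where "V j = (op_span (mults UNIV) ^^ j) UNIV" for j
  obtain p where p: "V p \<subseteq> {0}"
    using assms by (auto simp: nil_ops_def V_def)
  have V: "x \<odot> y \<in> V (Suc k)" if "x \<in> V k \<or> y \<in> V k" for x y k
    using that op_spanI[of "mult x" "mults UNIV" y "V k"] op_spanI[of "R y" "mults UNIV" x "V k"]
    by (auto simp: V_def mults_def)
  have "x \<in> V k" if "is_product mult m x" "m \<ge> 2 ^ k" for m x k
    using that
  proof (induction arbitrary: k rule: is_product.induct)
    case (single x)
    then have "k = 0" using less_exp[of k] by linarith
    then show ?case by (simp add: V_def)
  next
    case (prod i x j y)
    show ?case
    proof (cases k)
      case 0
      then show ?thesis by (simp add: V_def)
    next
      case (Suc l)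
      then have "i \<ge> 2 ^ l \<or> j \<ge> 2 ^ l" using prod.prems by auto
      then show ?thesis unfolding Suc using V prod.IH by blast
    qed
  qed
  then show ?thesis
    using p unfolding nilpotent_alg_def by (intro exI[of _ "2 ^ p"]) auto
qed

lemma is_product_foldl: "is_product mult i y \<Longrightarrow> is_product mult (i + length xs) (foldl mult y xs)"
proof (induction xs arbitrary: i y)
  case (Cons x xs)
  have "is_product mult (i + 1 + length xs) (foldl mult (y \<odot> x) xs)"
    by (intro Cons.IH is_product.intros Cons.prems)
  then show ?case by simp
qed simp

text \<open>For the identity map both sides of the Leibniz rule vanish at order
  \<open>Suc s\<close>, since the first \<open>s\<close> factors already multiply to zero. The extra
  factor makes the order at least 2 also when \<open>s = 1\<close>.\<close>

lemma nilpotent_imp_leibniz: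
  assumes "nilpotent_alg mult"
  shows "\<exists>n\<ge>2. \<exists>\<phi>. leibniz_derivation scale mult n \<phi> \<and> bij \<phi>"
proof -
  obtain s where s: "s \<ge> 1" "\<And>z. is_product mult s z \<Longrightarrow> z = 0"
    using assms by (auto simp: nilpotent_alg_def)
  have "lnprod mult xs = 0" if len: "length xs = Suc s" for xs
  proof -
    obtain y ws where ws: "xs = y # ws" "length ws = s" using len by (cases xs) auto
    then obtain zs z where zs: "ws = zs @ [z]" using s(1) by (cases ws rule: rev_cases) auto
    have "is_product mult (1 + length zs) (foldl mult y zs)"
      by (rule is_product_foldl) (rule is_product.single)
    then have "foldl mult y zs = 0" using s(2) ws zs by simp
    then show ?thesis by (simp add: ws zs mult_zero)
  qed
  then have "leibniz_derivation scale mult (Suc s) id"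
    unfolding leibniz_derivation_def by (auto intro: endoI)
  then show ?thesis using s(1) by (intro exI[of _ "Suc s"]) auto
qed

end

theorem theorem2p1:
  fixes scale :: "'k::field_char_0 \<Rightarrow> 'v::ab_group_add \<Rightarrow> 'v"
    and B :: "'v set"
    and mult :: "'v \<Rightarrow> 'v \<Rightarrow> 'v"
  assumes "finite_dimensional_vector_space scale B"
    and "bilinear_mult scale mult"
    and "alternative mult"
  shows "nilpotent_alg mult \<longleftrightarrow>
         (\<exists>n\<ge>2. \<exists>\<phi>. leibniz_derivation scale mult n \<phi> \<and> bij \<phi>)"
proof -
  interpret finite_dimensional_vector_space scale B by fact
  interpret alternative_algebra scale B mult
    by unfold_locales (fact assms)+
  show ?thesis
  proof
    assume "nilpotent_alg mult"
    then show "\<exists>n\<ge>2. \<exists>\<phi>. leibniz_derivation scale mult n \<phi> \<and> bij \<phi>"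
      by (rule nilpotent_imp_leibniz)
  next
    assume "\<exists>n\<ge>2. \<exists>\<phi>. leibniz_derivation scale mult n \<phi> \<and> bij \<phi>"
    then have "rad = UNIV" using rad_eq_UNIV by blast
    then show "nilpotent_alg mult"
      using rad_nil by (intro nil_ops_imp_nilpotent nil_imp_nil_ops) auto
  qed
qed

end
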